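(* Let $\Sigma$ be a signed graph with $n$ vertices and at least one positive edge. Let $B=-A(\Sigma_-)$, let $\lambda_1(\Sigma)\ge\cdots\ge\lambda_n(\Sigma)$ be the eigenvalues of $A(\Sigma)$, and let $\lambda_1(B)\ge\cdots\ge\lambda_n(B)$ be the eigenvalues of $B$. Then \[\chi(\Sigma)\ge 1+\max_{m=1,2,\dots,n-1}\frac{\sum_{i=1}^m\lambda_i(\Sigma)+\sum_{i=1}^m\lambda_{n-i+1}(B)}{-\sum_{i=1}^m\lambda_{n-i+1}(\Sigma)-\sum_{i=1}^m\lambda_{n-i+1}(B)}.\]
   Context: A signed graph $\Sigma=(G,\sigma)$ is a finite simple graph $G=(V,E)$ with a sign function $\sigma:E\to\{-1,+1\}$. The adjacency matrix $A(\Sigma)$ has $(i,j)$ entry $\sigma(v_iv_j)$ if $v_i\sim v_j$ and $0$ otherwise. $\Sigma_-$ is the spanning signed subgraph of $\Sigma$ (vertex set $V$) whose edges are exactly the negative edges, keeping their negative signs; thus $-A(\Sigma_-)$ is the ordinary $0/1$ adjacency matrix of the graph formed by the negative edges. For $k\ge1$ let $M_k=\{\pm1,\pm2,\dots,\pm k/2\}$ if $k$ is even and $M_k=\{0,\pm1,\dots,\pm(k-1)/2\}$ if $k$ is odd. A (proper) $k$-coloring of $\Sigma$ is a map $c:V\to M_k$ with $c(u)\ne\sigma(uv)c(v)$ for every edge $uv\in E$. The signed chromatic number $\chi(\Sigma)$ is the minimum $k$ for which $\Sigma$ admits a $k$-coloring. *)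

theory Defs
  imports "Jordan_Normal_Form.Char_Poly" "HOL-Library.FuncSet"
begin

(* An edge uv is the two-element set {u, v}; the sign function is only relevant on edges. *)
record 'a signed_graph =
  verts :: "'a set"
  edges :: "'a set set"
  edge_sign :: "'a set \<Rightarrow> int"

definition is_signed_graph :: "'a signed_graph \<Rightarrow> bool" where
  "is_signed_graph S \<longleftrightarrow>
     finite (verts S) \<and>
     (\<forall>e\<in>edges S. e \<subseteq> verts S \<and> card e = 2) \<and>
     (\<forall>e\<in>edges S. edge_sign S e \<in> {-1, 1})"

definition negative_part :: "'a signed_graph \<Rightarrow> 'a signed_graph" where
  "negative_part S = S\<lparr>edges := {e \<in> edges S. edge_sign S e = -1}\<rparr>"

(* The list vs is an enumeration v_1, ..., v_n of the vertices. There are no loops, so the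
   diagonal entries, for which the index set is a singleton, are 0. *)
definition adjacency_matrix :: "'a signed_graph \<Rightarrow> 'a list \<Rightarrow> real mat" where
  "adjacency_matrix S vs = mat (length vs) (length vs)
     (\<lambda>(i, j). if {vs ! i, vs ! j} \<in> edges S
               then real_of_int (edge_sign S {vs ! i, vs ! j}) else 0)"

(* eigval A i is the i-th largest eigenvalue (i = 1, ..., n), counted with algebraic multiplicity.
   For a real symmetric n x n matrix, all n roots of the characteristic polynomial are real, so
   the list has length n; for other real matrices the non-real eigenvalues would be missing. *)
definition eigval :: "real mat \<Rightarrow> nat \<Rightarrow> real" where
  "eigval A i = rev (sorted_list_of_multiset (proots (char_poly A))) ! (i - 1)"

definition color_set :: "nat \<Rightarrow> int set" where
  "color_set k = (if even k then {- (int k div 2)..int k div 2} - {0}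
                  else {- ((int k - 1) div 2)..(int k - 1) div 2})"

definition signed_coloring :: "'a signed_graph \<Rightarrow> nat \<Rightarrow> ('a \<Rightarrow> int) \<Rightarrow> bool" where
  "signed_coloring S k c \<longleftrightarrow>
     c \<in> verts S \<rightarrow> color_set k \<and>
     (\<forall>u v. {u, v} \<in> edges S \<longrightarrow> c u \<noteq> edge_sign S {u, v} * c v)"

(* The set of admissible k is nonempty for a finite signed graph: with k = 2|V| one may give the
   vertices pairwise distinct positive colors. *)
definition signed_chromatic_number :: "'a signed_graph \<Rightarrow> nat" where
  "signed_chromatic_number S = (LEAST k. 1 \<le> k \<and> (\<exists>c. signed_coloring S k c))"

end

theory Submission
  imports Defs "Jordan_Normal_Form.Schur_Decomposition"
begin

text \<open>
Write \<open>A = A\<^sub>+ - B\<close>, where \<open>A\<^sub>+\<close> and \<open>B\<close> are the ordinary adjacency matrices of the positive and of the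
negative edges. In a proper coloring of a signed graph two vertices of equal color are never joined
by a positive edge, so \<open>A + B = A\<^sub>+\<close> vanishes on all pairs of equal color: the coloring is a proper
coloring of the graph of positive edges in the ordinary sense. The bound is the Hoffman bound for
\<open>A\<^sub>+\<close>, with sums of \<open>m\<close> eigenvalues in place of single ones and with the contributions of \<open>A\<close> and \<open>B\<close>
kept apart.

The proof compares trace inner products \<open>\<langle>M, X\<rangle> = tr (M\<^sup>T X)\<close>. Call \<open>X\<close> a fractional projection of rank
\<open>m\<close> if \<open>0 \<le> X \<le> 1\<close> as quadratic forms and \<open>tr X = m\<close>. By Ky Fan's principle, \<open>\<langle>M, X\<rangle>\<close> is at least the
sum of the \<open>m\<close> least eigenvalues of a symmetric \<open>M\<close> (\<open>least_eigenvalues_le_mat_inner\<close>), and the sum of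
the \<open>m\<close> greatest ones is \<open>\<langle>M, P\<rangle>\<close> for some \<open>P\<close> of this kind (\<open>greatest_eigenvalues_attained\<close>). Take \<open>P\<close> for \<open>A\<close>. The
numerator is then at most \<open>\<langle>A, P\<rangle> + \<langle>B, P\<rangle> = \<langle>A\<^sub>+, P\<rangle>\<close>.

Let \<open>X\<close> arise from \<open>P\<close> by multiplying the entries at pairs of different color by \<open>-1/(k-1)\<close>. These
factors form the Gram matrix of the \<open>k\<close> vertices of a regular simplex, so \<open>X\<close> is a Schur product with
a positive semidefinite matrix of unit diagonal and is again a fractional projection
(\<open>fractional_projection_simplex_twist\<close>). Since \<open>A\<^sub>+\<close> is supported on pairs of different color,
\<open>\<langle>A\<^sub>+, P\<rangle> = -(k-1) \<langle>A\<^sub>+, X\<rangle> = -(k-1) (\<langle>A, X\<rangle> + \<langle>B, X\<rangle>)\<close>, and Ky Fan's principle bounds this by \<open>k-1\<close> times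
the denominator (\<open>eigenvalue_ratio_bound\<close>). The twist is a real substitute for conjugating with
powers of a diagonal matrix of \<open>k\<close>-th roots of unity.
\<close>

section \<open>The spectral theorem for real symmetric matrices\<close>

text \<open>
For an eigenvector \<open>v\<close> the number \<open>v\<^sup>* A v = e \<parallel>v\<parallel>\<^sup>2\<close> equals its own conjugate.
\<close>

lemma symmetric_eigenvalue_real:
  fixes A :: "real mat"
  assumes A: "A \<in> carrier_mat n n" and sym: "transpose_mat A = A"
    and ev: "eigenvalue (map_mat complex_of_real A) e"
  shows "e \<in> \<real>"
proof -
  let ?C = "map_mat complex_of_real A"
  have C: "?C \<in> carrier_mat n n" using A by simp
  obtain v where "eigenvector ?C v e" using ev unfolding eigenvalue_def by blast
  then have v: "v \<in> carrier_vec n" and v0: "v \<noteq> 0\<^sub>v n" and eq: "?C *\<^sub>v v = e \<cdot>\<^sub>v v"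
    using A unfolding eigenvector_def by auto
  have S: "A $$ (i, j) = A $$ (j, i)" if "i < n" "j < n" for i j
    using sym A that by (metis carrier_matD index_transpose_mat(1))
  have row: "(\<Sum>j<n. of_real (A $$ (i, j)) * v $ j) = e * v $ i" if "i < n" for i
    using arg_cong[OF eq, of "\<lambda>w. w $ i"] that A v
    by (simp add: scalar_prod_def atLeast0LessThan)
  define s where "s = (\<Sum>i<n. \<Sum>j<n. cnj (v $ i) * (of_real (A $$ (i, j)) * v $ j))"
  define N where "N = (\<Sum>i<n. (cmod (v $ i))\<^sup>2)"
  have "s = (\<Sum>i<n. cnj (v $ i) * (e * v $ i))"
    unfolding s_def by (simp add: sum_distrib_left[symmetric] row)
  also have "\<dots> = e * of_real N"
    unfolding N_def of_real_sum sum_distrib_left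
    by (intro sum.cong refl) (simp only: complex_norm_square mult_ac)
  finally have "s = e * of_real N" .
  moreover have "cnj s = s"
  proof -
    have "cnj s = (\<Sum>i<n. \<Sum>j<n. v $ i * (of_real (A $$ (i, j)) * cnj (v $ j)))"
      unfolding s_def by simp
    also have "\<dots> = (\<Sum>j<n. \<Sum>i<n. v $ i * (of_real (A $$ (i, j)) * cnj (v $ j)))"
      by (rule sum.swap)
    also have "\<dots> = s"
      unfolding s_def by (intro sum.cong refl) (auto simp: S mult_ac)
    finally show ?thesis .
  qed
  moreover have "N \<noteq> 0"
  proof
    assume "N = 0"
    then have "\<forall>i\<in>{..<n}. (cmod (v $ i))\<^sup>2 = 0"
      unfolding N_def by (subst (asm) sum_nonneg_eq_0_iff) auto
    then have "v = 0\<^sub>v n" using v by (intro eq_vecI) auto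
    with v0 show False by simp
  qed
  ultimately have "cnj e = e" by (metis complex_cnj_complex_of_real complex_cnj_mult
      mult_right_cancel of_real_eq_0_iff)
  then show ?thesis by (simp add: Reals_cnj_iff)
qed

text \<open>
Over the complex numbers the polynomial splits, and all its roots are real.
\<close>

lemma symmetric_char_poly_splits:
  fixes A :: "real mat"
  assumes A: "A \<in> carrier_mat n n" and sym: "transpose_mat A = A"
  obtains es where "char_poly A = (\<Prod>e\<leftarrow>es. [:- e, 1:])"
proof -
  let ?C = "map_mat complex_of_real A"
  have C: "?C \<in> carrier_mat n n" using A by simp
  interpret h: map_poly_inj_comm_ring_hom complex_of_real ..
  obtain as where as: "char_poly ?C = (\<Prod>a\<leftarrow>as. [:- a, 1:])"
    using char_poly_factorized[OF C] by blast
  have "map (\<lambda>a. complex_of_real (Re a)) as = as"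
  proof (rule map_idI)
    fix a assume "a \<in> set as"
    then have "poly (char_poly ?C) a = 0"
      unfolding as poly_prod_list by (auto simp: prod_list_zero_iff)
    then have "a \<in> \<real>"
      using symmetric_eigenvalue_real[OF A sym] eigenvalue_root_char_poly[OF C] by blast
    then show "complex_of_real (Re a) = a" by simp
  qed
  then have "char_poly ?C = (\<Prod>a\<leftarrow>map (\<lambda>a. complex_of_real (Re a)) as. [:- a, 1:])"
    using as by simp
  also have "\<dots> = map_poly complex_of_real (\<Prod>e\<leftarrow>map Re as. [:- e, 1:])"
    by (simp add: h.hom_prod_list o_def)
  finally have "map_poly complex_of_real (char_poly A)
      = map_poly complex_of_real (\<Prod>e\<leftarrow>map Re as. [:- e, 1:])"
    using of_real_hom.char_poly_hom[OF A, where ?'a = complex] by simp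
  then have "char_poly A = (\<Prod>e\<leftarrow>map Re as. [:- e, 1:])" by simp
  then show thesis by (rule that)
qed

lemma proots_prod_linear:
  fixes es :: "real list"
  shows "proots (\<Prod>e\<leftarrow>es. [:- e, 1:]) = mset es"
proof (induction es)
  case (Cons e es)
  have "monic (\<Prod>e\<leftarrow>es. [:- e, 1:])" by (rule monic_prod_list) auto
  then have "(\<Prod>e\<leftarrow>es. [:- e, 1:]) \<noteq> 0" by force
  then show ?case by (simp add: proots_mult Cons.IH del: mult_pCons_left)
qed simp

text \<open>
Gram--Schmidt leaves the first vector of a basis unchanged; scaling the resulting orthogonal vectors to
norm one makes the matrix of columns orthogonal.
\<close>

lemma orthonormal_completion:
  fixes v :: "real vec"
  assumes v: "v \<in> carrier_vec n" and unit: "v \<bullet> v = 1"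
  obtains W where "W \<in> carrier_mat n n" "transpose_mat W * W = 1\<^sub>m n" "col W 0 = v" "n > 0"
proof -
  interpret cof_vec_space n "TYPE(real)" .
  have v0: "v \<noteq> 0\<^sub>v n" using unit v by auto
  then have n: "n > 0" using v by (cases n) auto
  define b where "b = basis_completion v"
  define ws where "ws = gram_schmidt n b"
  note bc = basis_completion[OF v v0, folded b_def]
  obtain vs where bv: "b = v # vs" using bc(6,7) n by (cases b) auto
  have ws: "set ws \<subseteq> carrier_vec n" "corthogonal ws" "length ws = n"
    using gram_schmidt_result[OF bc(2,4,5) refl, folded ws_def] bc(6) by auto
  have hd: "ws ! 0 = v"
    using gram_schmidt_hd[OF v, of vs, folded bv ws_def] ws(3) n by (cases ws) auto
  have wsi: "ws ! i \<in> carrier_vec n" if "i < n" for i using ws that by auto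
  have orth: "ws ! i \<bullet> ws ! j = 0 \<longleftrightarrow> i \<noteq> j" if "i < n" "j < n" for i j
    using corthogonalD[OF ws(2)] that ws(3) by simp
  define us where "us i = (1 / sqrt (ws ! i \<bullet> ws ! i)) \<cdot>\<^sub>v ws ! i" for i
  define W where "W = mat_of_cols n (map us [0..<n])"
  have us: "us i \<in> carrier_vec n" if "i < n" for i using wsi[OF that] by (simp add: us_def)
  have W: "W \<in> carrier_mat n n" using mat_of_cols_carrier(1)[of n "map us [0..<n]"] by (simp add: W_def)
  have colW: "col W i = us i" if "i < n" for i
    using that us by (simp add: W_def)
  have "transpose_mat W * W = 1\<^sub>m n"
  proof (rule eq_matI)
    fix i j assume "i < dim_row (1\<^sub>m n :: real mat)" "j < dim_col (1\<^sub>m n :: real mat)"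
    then have ij: "i < n" "j < n" by auto
    have "ws ! i \<bullet> ws ! i \<ge> 0" using wsi[OF ij(1)]
      by (auto simp: scalar_prod_def intro!: sum_nonneg)
    then have pos: "ws ! i \<bullet> ws ! i > 0" using orth[OF ij(1,1)] by simp
    have "us i \<bullet> us j = (1 / sqrt (ws ! i \<bullet> ws ! i)) * ((1 / sqrt (ws ! j \<bullet> ws ! j)) * (ws ! i \<bullet> ws ! j))"
      unfolding us_def using wsi[OF ij(1)] wsi[OF ij(2)]
      by (metis scalar_prod_smult_distrib smult_carrier_vec smult_scalar_prod_distrib)
    also have "\<dots> = (if i = j then 1 else 0)"
      using orth[OF ij] pos by auto
    finally show "(transpose_mat W * W) $$ (i, j) = 1\<^sub>m n $$ (i, j)"
      using W ij by (simp add: colW)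
  qed (use W in auto)
  moreover have "col W 0 = v" using n hd unit by (simp add: colW us_def)
  ultimately show thesis using W n that by blast
qed

lemma mult_block_diagonal:
  fixes A1 A2 D1 D2 :: "'a :: comm_ring_1 mat"
  assumes "A1 \<in> carrier_mat h h" "D1 \<in> carrier_mat k k" "A2 \<in> carrier_mat h h" "D2 \<in> carrier_mat k k"
  shows "four_block_mat A1 (0\<^sub>m h k) (0\<^sub>m k h) D1 * four_block_mat A2 (0\<^sub>m h k) (0\<^sub>m k h) D2
    = four_block_mat (A1 * A2) (0\<^sub>m h k) (0\<^sub>m k h) (D1 * D2)"
  using assms
  by (simp add: mult_four_block_mat[OF assms(1) zero_carrier_mat zero_carrier_mat assms(2)
        assms(3) zero_carrier_mat zero_carrier_mat assms(4)])

text \<open>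
Deflation: in an orthonormal basis that starts with an eigenvector for \<open>e\<close>, the symmetric matrix
becomes block diagonal with blocks \<open>e\<close> and \<open>A3\<close>, and the induction hypothesis applies to \<open>A3\<close>. Any
ordering \<open>es\<close> of the roots can be prescribed for the diagonal; below it is the decreasing one.
\<close>

lemma orthogonal_diagonalization:
  fixes A :: "real mat"
  assumes "A \<in> carrier_mat n n" and "transpose_mat A = A"
    and "char_poly A = (\<Prod>e\<leftarrow>es. [:- e, 1:])"
  shows "\<exists>Q\<in>carrier_mat n n. transpose_mat Q * Q = 1\<^sub>m n \<and>
           transpose_mat Q * A * Q = mat_diag n (\<lambda>i. es ! i)"
  using assms
proof (induction es arbitrary: n A)
  case Nil
  then have "n = 0" using degree_monic_char_poly[of A n] by simp
  then show ?case using Nil.prems(1) by (intro bexI[of _ "1\<^sub>m n"]) (auto simp: mat_diag_def)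
next
  case (Cons e es)
  note A = Cons.prems(1) and sym = Cons.prems(2)
  have "eigenvalue A e"
    unfolding eigenvalue_root_char_poly[OF A] Cons.prems(3) by simp
  then obtain u where u: "u \<in> carrier_vec n" "u \<noteq> 0\<^sub>v n" "A *\<^sub>v u = e \<cdot>\<^sub>v u"
    using A unfolding eigenvalue_def eigenvector_def by auto
  have upos: "u \<bullet> u > 0"
    using conjugate_square_greater_0_vec[OF u(1)] u(2) by simp
  define v where "v = (1 / sqrt (u \<bullet> u)) \<cdot>\<^sub>v u"
  have v: "v \<in> carrier_vec n" using u by (simp add: v_def)
  have Av: "A *\<^sub>v v = e \<cdot>\<^sub>v v"
    unfolding v_def using A u by (simp add: mult_mat_vec smult_smult_assoc mult.commute)
  have "v \<bullet> v = (1 / sqrt (u \<bullet> u)) * ((1 / sqrt (u \<bullet> u)) * (u \<bullet> u))"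
    unfolding v_def using u(1)
    by (metis scalar_prod_smult_distrib smult_carrier_vec smult_scalar_prod_distrib)
  also have "\<dots> = 1" using upos by simp
  finally have "v \<bullet> v = 1" .
  then obtain W where W: "W \<in> carrier_mat n n" and WW: "transpose_mat W * W = 1\<^sub>m n"
    and col0: "col W 0 = v" and n: "n > 0"
    using orthonormal_completion[OF v] by blast
  let ?V = "transpose_mat W"
  have V: "?V \<in> carrier_mat n n" using W by simp
  have WV: "W * ?V = 1\<^sub>m n" by (rule mat_mult_left_right_inverse[OF V W WW])
  define A' where "A' = ?V * A * W"
  have A': "A' \<in> carrier_mat n n" using A W by (simp add: A'_def)
  have symA': "transpose_mat A' = A'"
    unfolding A'_def using A W V sym
    by (simp add: transpose_mult[of _ n n _ n] assoc_mult_mat[of _ n n _ n _ n])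
  have sim: "similar_mat A' A"
    unfolding similar_mat_def
    by (intro exI, rule similar_mat_witI[OF WW WV A'_def A' A V W])
  have col0': "A' $$ (i, 0) = (if i = 0 then e else 0)" if "i < n" for i
  proof -
    have "A' = ?V * (A * W)" unfolding A'_def using A W by (simp add: assoc_mult_mat[of _ n n _ n _ n])
    then have "A' $$ (i, 0) = row ?V i \<bullet> col (A * W) 0" using A W n that by simp
    also have "col (A * W) 0 = e \<cdot>\<^sub>v v" unfolding col_mult2[OF A W n] col0 Av ..
    also have "row ?V i \<bullet> (e \<cdot>\<^sub>v v) = e * (row ?V i \<bullet> col W 0)"
      using V v that by (simp add: col0)
    also have "row ?V i \<bullet> col W 0 = (?V * W) $$ (i, 0)" using W n that by simp
    finally show ?thesis unfolding WW using that n by simp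
  qed
  have row0': "A' $$ (0, i) = (if i = 0 then e else 0)" if "i < n" for i
    using col0'[OF that] symA' A' n that by (metis carrier_matD index_transpose_mat(1))
  define E where "E = mat 1 1 (\<lambda>_. e)"
  define A3 where "A3 = mat (n - 1) (n - 1) (\<lambda>(i, j). A' $$ (Suc i, Suc j))"
  have E: "E \<in> carrier_mat 1 1" and A3: "A3 \<in> carrier_mat (n - 1) (n - 1)"
    by (auto simp: E_def A3_def)
  have block: "A' = four_block_mat E (0\<^sub>m 1 (n - 1)) (0\<^sub>m (n - 1) 1) A3"
    by (rule eq_matI) (use A' n col0' row0' in \<open>auto simp: E_def A3_def\<close>)
  have "transpose_mat A3 = A3"
  proof (rule eq_matI)
    fix i j assume "i < dim_row A3" "j < dim_col A3"
    then have ij: "Suc i < n" "Suc j < n" using A3 by auto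
    then have "A' $$ (Suc j, Suc i) = A' $$ (Suc i, Suc j)"
      using symA' A' by (metis carrier_matD index_transpose_mat(1))
    then show "transpose_mat A3 $$ (i, j) = A3 $$ (i, j)" using ij by (simp add: A3_def)
  qed (use A3 in auto)
  moreover have "char_poly A3 = (\<Prod>e\<leftarrow>es. [:- e, 1:])"
  proof -
    have "char_poly E = [:- e, 1:]" by (simp add: E_def char_poly_defs det_def sign_def)
    moreover have "char_poly A' = char_poly E * char_poly A3"
      unfolding block by (rule char_poly_four_block_zeros_col[OF E _ A3]) simp
    ultimately have "[:- e, 1:] * char_poly A3 = [:- e, 1:] * (\<Prod>e\<leftarrow>es. [:- e, 1:])"
      using char_poly_similar[OF sim] Cons.prems(3) by simp
    then show ?thesis by (metis mult_cancel_left pCons_eq_0_iff zero_neq_one)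
  qed
  ultimately obtain Q' where Q': "Q' \<in> carrier_mat (n - 1) (n - 1)"
    and QQ': "transpose_mat Q' * Q' = 1\<^sub>m (n - 1)"
    and diag': "transpose_mat Q' * A3 * Q' = mat_diag (n - 1) (\<lambda>i. es ! i)"
    using Cons.IH[OF A3] by blast
  define F where "F = four_block_mat (1\<^sub>m 1) (0\<^sub>m 1 (n - 1)) (0\<^sub>m (n - 1) 1) Q'"
  have F: "F \<in> carrier_mat n n" using Q' n by (auto simp: F_def)
  have tF: "transpose_mat F =
      four_block_mat (1\<^sub>m 1) (0\<^sub>m 1 (n - 1)) (0\<^sub>m (n - 1) 1) (transpose_mat Q')"
    unfolding F_def by (subst transpose_four_block_mat[where ?nr2.0 = "n - 1" and ?nc2.0 = "n - 1"]) (use Q' in auto)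
  have FF: "transpose_mat F * F = 1\<^sub>m n"
  proof -
    have "transpose_mat F * F =
        four_block_mat (1\<^sub>m 1) (0\<^sub>m 1 (n - 1)) (0\<^sub>m (n - 1) 1) (transpose_mat Q' * Q')"
      unfolding tF unfolding F_def
      by (subst mult_block_diagonal[where h = 1 and k = "n - 1"]) (use Q' in auto)
    also have "\<dots> = 1\<^sub>m n" unfolding QQ' by (rule eq_matI) (use n in auto)
    finally show ?thesis .
  qed
  have FAF: "transpose_mat F * A' * F = mat_diag n (\<lambda>i. (e # es) ! i)"
  proof -
    have "transpose_mat F * A' =
        four_block_mat E (0\<^sub>m 1 (n - 1)) (0\<^sub>m (n - 1) 1) (transpose_mat Q' * A3)"
      unfolding tF block
      by (subst mult_block_diagonal[where h = 1 and k = "n - 1"]) (use Q' E A3 in auto)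
    also have "\<dots> * F =
        four_block_mat E (0\<^sub>m 1 (n - 1)) (0\<^sub>m (n - 1) 1) (transpose_mat Q' * A3 * Q')"
      unfolding F_def
      by (subst mult_block_diagonal[where h = 1 and k = "n - 1"]) (use Q' E A3 in auto)
    also have "\<dots> = mat_diag n (\<lambda>i. (e # es) ! i)"
      unfolding diag' by (rule eq_matI) (use n in \<open>auto simp: E_def mat_diag_def nth_Cons'\<close>)
    finally show ?thesis .
  qed
  let ?Q = "W * F"
  have tQ: "transpose_mat ?Q = transpose_mat F * ?V" using W F by (simp add: transpose_mult)
  have tF': "transpose_mat F \<in> carrier_mat n n" using F by simp
  have "transpose_mat ?Q * ?Q = transpose_mat F * (?V * W) * F"
    unfolding tQ using W F V tF' by (simp add: assoc_mult_mat[of _ n n _ n _ n])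
  also have "\<dots> = 1\<^sub>m n" unfolding WW using F tF' FF by simp
  finally have "transpose_mat ?Q * ?Q = 1\<^sub>m n" .
  moreover have "transpose_mat ?Q * A * ?Q = transpose_mat F * A' * F"
    unfolding tQ A'_def using W F V tF' A by (simp add: assoc_mult_mat[of _ n n _ n _ n])
  ultimately show ?case using FAF W F by (intro bexI[of _ ?Q]) auto
qed

text \<open>
The form in which the spectral theorem is used: \<open>q i\<close> is an eigenvector for the eigenvalue with
number \<open>i + 1\<close>. The matrix of the \<open>q i\<close> is orthogonal, so both its columns and its rows are orthonormal;
the second fact says that the projections onto the eigenvectors add up to the identity.
\<close>

lemma symmetric_spectral_decomposition:
  fixes A :: "real mat"
  assumes A: "A \<in> carrier_mat n n" and sym: "transpose_mat A = A"
  obtains q :: "nat \<Rightarrow> nat \<Rightarrow> real" where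
    "\<And>u v. u < n \<Longrightarrow> v < n \<Longrightarrow> A $$ (u, v) = (\<Sum>i<n. eigval A (Suc i) * (q i u * q i v))"
    "\<And>u v. u < n \<Longrightarrow> v < n \<Longrightarrow> (\<Sum>i<n. q i u * q i v) = of_bool (u = v)"
    "\<And>i j. i < n \<Longrightarrow> j < n \<Longrightarrow> (\<Sum>u<n. q i u * q j u) = of_bool (i = j)"
    "\<And>i j. i \<le> j \<Longrightarrow> j < n \<Longrightarrow> eigval A (Suc j) \<le> eigval A (Suc i)"
proof -
  obtain fs where fs: "char_poly A = (\<Prod>e\<leftarrow>fs. [:- e, 1:])"
    using symmetric_char_poly_splits[OF A sym] .
  define es where "es = rev (sorted_list_of_multiset (proots (char_poly A)))"
  have mset: "mset es = mset fs" by (simp add: es_def fs proots_prod_linear)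
  have len: "length es = n"
  proof -
    have "length es = size (proots (char_poly A))"
      by (metis es_def mset_rev mset_sorted_list_of_multiset size_mset)
    also have "\<dots> = length fs" by (simp add: fs proots_prod_linear)
    also have "\<dots> = degree (char_poly A)" unfolding fs by (simp add: degree_linear_factors)
    finally show ?thesis using degree_monic_char_poly[OF A] by simp
  qed
  have "char_poly A = (\<Prod>e\<leftarrow>es. [:- e, 1:])"
    unfolding fs by (metis mset mset_map prod_mset_prod_list)
  then obtain Q where Q: "Q \<in> carrier_mat n n" and QQ: "transpose_mat Q * Q = 1\<^sub>m n"
    and diag: "transpose_mat Q * A * Q = mat_diag n (\<lambda>i. es ! i)"
    using orthogonal_diagonalization[OF A sym] by blast
  let ?T = "transpose_mat Q"
  have T: "?T \<in> carrier_mat n n" using Q by simp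
  have QT: "Q * ?T = 1\<^sub>m n" by (rule mat_mult_left_right_inverse[OF T Q QQ])
  let ?D = "mat_diag n (\<lambda>i. es ! i)"
  have "Q * ?D * ?T = (Q * ?T) * A * (Q * ?T)"
    unfolding diag[symmetric] using Q T A by (simp add: assoc_mult_mat[of _ n n _ n _ n])
  also have "\<dots> = A" unfolding QT using A by simp
  finally have decomp: "A = Q * ?D * ?T" by simp
  have eig: "eigval A (Suc i) = es ! i" for i by (simp add: eigval_def es_def)
  show thesis
  proof (rule that[of "\<lambda>i u. Q $$ (u, i)"])
    fix u v assume uv: "u < n" "v < n"
    have "A $$ (u, v) = (Q * ?D * ?T) $$ (u, v)" using decomp by simp
    also have "\<dots> = (\<Sum>i<n. Q $$ (u, i) * es ! i * Q $$ (v, i))"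
      using Q uv by (simp add: scalar_prod_def atLeast0LessThan mat_diag_mult_right)
    finally show "A $$ (u, v) = (\<Sum>i<n. eigval A (Suc i) * (Q $$ (u, i) * Q $$ (v, i)))"
      by (simp add: eig mult_ac)
    have "(\<Sum>i<n. Q $$ (u, i) * Q $$ (v, i)) = (Q * ?T) $$ (u, v)"
      using Q uv by (simp add: scalar_prod_def atLeast0LessThan)
    then show "(\<Sum>i<n. Q $$ (u, i) * Q $$ (v, i)) = of_bool (u = v)"
      unfolding QT using uv by simp
  next
    fix i j assume ij: "i < n" "j < n"
    have "(\<Sum>u<n. Q $$ (u, i) * Q $$ (u, j)) = (?T * Q) $$ (i, j)"
      using Q ij by (simp add: scalar_prod_def atLeast0LessThan)
    then show "(\<Sum>u<n. Q $$ (u, i) * Q $$ (u, j)) = of_bool (i = j)"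
      unfolding QQ using ij by simp
  next
    fix i j assume "i \<le> j" "j < n"
    then show "eigval A (Suc j) \<le> eigval A (Suc i)"
      unfolding eig using len sorted_rev_nth_mono[of es i j] by (simp add: es_def)
  qed
qed

section \<open>Ky Fan's principle for sums of eigenvalues\<close>

text \<open>
Matrices that only serve as test objects are functions on pairs of indices, of which the values
below \<open>n\<close> matter; this spares them all carrier conditions.
\<close>

definition quad_form :: "nat \<Rightarrow> (nat \<Rightarrow> nat \<Rightarrow> real) \<Rightarrow> (nat \<Rightarrow> real) \<Rightarrow> real" where
  "quad_form n X x = (\<Sum>u<n. \<Sum>v<n. X u v * (x u * x v))"

definition psd :: "nat \<Rightarrow> (nat \<Rightarrow> nat \<Rightarrow> real) \<Rightarrow> bool" where
  "psd n X \<longleftrightarrow> (\<forall>x. quad_form n X x \<ge> 0)"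

text \<open>
The convex hull of the orthogonal projections of rank \<open>m\<close>, up to an antisymmetric part, which affects
neither quadratic forms nor inner products with symmetric matrices.
\<close>

definition fractional_projection :: "nat \<Rightarrow> nat \<Rightarrow> (nat \<Rightarrow> nat \<Rightarrow> real) \<Rightarrow> bool" where
  "fractional_projection n m X \<longleftrightarrow>
     psd n X \<and> psd n (\<lambda>u v. of_bool (u = v) - X u v) \<and> (\<Sum>u<n. X u u) = real m"

text \<open>
The trace (Frobenius) inner product.
\<close>

definition mat_inner :: "nat \<Rightarrow> real mat \<Rightarrow> (nat \<Rightarrow> nat \<Rightarrow> real) \<Rightarrow> real" where
  "mat_inner n A X = (\<Sum>u<n. \<Sum>v<n. A $$ (u, v) * X u v)"

lemma sum_of_bool_mult:
  fixes f :: "nat \<Rightarrow> real"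
  assumes "u < n"
  shows "(\<Sum>v<n. of_bool (u = v) * f v) = f u"
  using assms by (simp add: of_bool_def if_distrib[of "\<lambda>b. b * _"] cong: if_cong)

lemma quad_form_identity:
  "quad_form n (\<lambda>u v. of_bool (u = v)) x = (\<Sum>u<n. (x u)\<^sup>2)"
  unfolding quad_form_def
  by (intro sum.cong refl) (auto simp: sum_of_bool_mult power2_eq_square)

lemma quad_form_diff:
  "quad_form n (\<lambda>u v. X u v - Y u v) x = quad_form n X x - quad_form n Y x"
  unfolding quad_form_def by (simp add: left_diff_distrib sum_subtractf)

lemma quad_form_gram:
  assumes "finite I"
  shows "quad_form n (\<lambda>u v. \<Sum>i\<in>I. q i u * q i v) x = (\<Sum>i\<in>I. (\<Sum>u<n. q i u * x u)\<^sup>2)"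
proof -
  have "quad_form n (\<lambda>u v. \<Sum>i\<in>I. q i u * q i v) x =
      (\<Sum>u<n. \<Sum>v<n. \<Sum>i\<in>I. (q i u * x u) * (q i v * x v))"
    unfolding quad_form_def sum_distrib_right by (simp add: mult_ac)
  also have "\<dots> = (\<Sum>u<n. \<Sum>i\<in>I. \<Sum>v<n. (q i u * x u) * (q i v * x v))"
    by (intro sum.cong refl sum.swap)
  also have "\<dots> = (\<Sum>i\<in>I. \<Sum>u<n. \<Sum>v<n. (q i u * x u) * (q i v * x v))"
    by (rule sum.swap)
  finally show ?thesis by (simp add: power2_eq_square sum_product)
qed

lemma mat_inner_spectral:
  assumes "\<And>u v. u < n \<Longrightarrow> v < n \<Longrightarrow> A $$ (u, v) = (\<Sum>i<n. d i * (q i u * q i v))"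
  shows "mat_inner n A X = (\<Sum>i<n. d i * quad_form n X (q i))"
proof -
  have "mat_inner n A X = (\<Sum>u<n. \<Sum>v<n. \<Sum>i<n. d i * (X u v * (q i u * q i v)))"
    unfolding mat_inner_def
    by (intro sum.cong refl) (simp add: assms sum_distrib_left mult_ac)
  also have "\<dots> = (\<Sum>u<n. \<Sum>i<n. \<Sum>v<n. d i * (X u v * (q i u * q i v)))"
    by (intro sum.cong refl sum.swap)
  also have "\<dots> = (\<Sum>i<n. \<Sum>u<n. \<Sum>v<n. d i * (X u v * (q i u * q i v)))"
    by (rule sum.swap)
  finally show ?thesis unfolding quad_form_def sum_distrib_left .
qed

text \<open>
Moving weight from larger to smaller values lowers the sum, and capacity one per index forces the
minimum to fill exactly the last \<open>m\<close> places. Formally, \<open>d i - d (n - m)\<close> and the deviation of \<open>w i\<close>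
from this extreme weighting have the same sign at every index.
\<close>

lemma weighted_sum_ge_least:
  fixes d w :: "nat \<Rightarrow> real"
  assumes mono: "\<And>i j. i \<le> j \<Longrightarrow> j < n \<Longrightarrow> d j \<le> d i"
    and w: "\<And>i. i < n \<Longrightarrow> 0 \<le> w i \<and> w i \<le> 1" and total: "(\<Sum>i<n. w i) = real m"
    and m: "1 \<le> m" "m \<le> n"
  shows "(\<Sum>i\<in>{n - m..<n}. d i) \<le> (\<Sum>i<n. d i * w i)"
proof -
  define b :: "nat \<Rightarrow> real" where "b i = of_bool (n - m \<le> i)" for i
  have restrict: "(\<Sum>i<n. f i * b i) = (\<Sum>i\<in>{n - m..<n}. f i)" for f :: "nat \<Rightarrow> real"
    by (rule sum.mono_neutral_cong_right) (auto simp: b_def)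
  have "(\<Sum>i<n. w i - b i) = 0"
    using restrict[of "\<lambda>_. 1"] total m by (simp add: sum_subtractf)
  then have "(\<Sum>i<n. d i * w i) - (\<Sum>i<n. d i * b i) = (\<Sum>i<n. (d i - d (n - m)) * (w i - b i))"
    by (simp add: left_diff_distrib right_diff_distrib sum_subtractf flip: sum_distrib_left)
  also have "\<dots> \<ge> 0"
  proof (rule sum_nonneg)
    fix i assume "i \<in> {..<n}"
    then have i: "i < n" by simp
    show "(d i - d (n - m)) * (w i - b i) \<ge> 0"
    proof (cases "n - m \<le> i")
      case True
      then show ?thesis using mono[OF True i] w[OF i] by (simp add: b_def mult_nonpos_nonpos)
    next
      case False
      then have "d (n - m) \<le> d i" using m by (intro mono) auto
      then show ?thesis using False w[OF i] by (simp add: b_def)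
    qed
  qed
  finally show ?thesis by (simp add: restrict)
qed

text \<open>
In an eigenbasis the inner product is a weighted sum of the eigenvalues, whose weights are the diagonal
entries of \<open>X\<close> in that basis; they lie between 0 and 1 and add up to the trace \<open>m\<close>.
\<close>

lemma least_eigenvalues_le_mat_inner:
  fixes A :: "real mat"
  assumes A: "A \<in> carrier_mat n n" and sym: "transpose_mat A = A"
    and X: "fractional_projection n m X" and m: "1 \<le> m" "m \<le> n"
  shows "(\<Sum>i=1..m. eigval A (n - i + 1)) \<le> mat_inner n A X"
proof -
  obtain q where spec: "\<And>u v. u < n \<Longrightarrow> v < n \<Longrightarrow>
        A $$ (u, v) = (\<Sum>i<n. eigval A (Suc i) * (q i u * q i v))"
    and complete: "\<And>u v. u < n \<Longrightarrow> v < n \<Longrightarrow> (\<Sum>i<n. q i u * q i v) = of_bool (u = v)"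
    and orth: "\<And>i j. i < n \<Longrightarrow> j < n \<Longrightarrow> (\<Sum>u<n. q i u * q j u) = of_bool (i = j)"
    and mono: "\<And>i j. i \<le> j \<Longrightarrow> j < n \<Longrightarrow> eigval A (Suc j) \<le> eigval A (Suc i)"
    using symmetric_spectral_decomposition[OF A sym] by blast
  have "(\<Sum>i=1..m. eigval A (n - i + 1)) = (\<Sum>i\<in>{n - m..<n}. eigval A (Suc i))"
    by (rule sum.reindex_bij_witness[where i = "\<lambda>j. n - j" and j = "\<lambda>i. n - i"]) (use m in auto)
  also have "\<dots> \<le> (\<Sum>i<n. eigval A (Suc i) * quad_form n X (q i))"
  proof (rule weighted_sum_ge_least[OF mono _ _ m])
    fix i assume i: "i < n"
    have "quad_form n (\<lambda>u v. of_bool (u = v)) (q i) = 1"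
      using orth[OF i i] by (simp add: quad_form_identity power2_eq_square)
    then show "0 \<le> quad_form n X (q i) \<and> quad_form n X (q i) \<le> 1"
      using X unfolding fractional_projection_def psd_def quad_form_diff by (metis diff_ge_0_iff_ge)
  next
    have "(\<Sum>i<n. quad_form n X (q i)) = mat_inner n (1\<^sub>m n) X"
      using mat_inner_spectral[of n "1\<^sub>m n" "\<lambda>_. 1" q X] complete by simp
    also have "\<dots> = (\<Sum>u<n. \<Sum>v<n. of_bool (u = v) * X u v)"
      unfolding mat_inner_def by (intro sum.cong refl) auto
    also have "\<dots> = (\<Sum>u<n. X u u)"
      by (intro sum.cong refl) (auto simp: sum_of_bool_mult)
    finally show "(\<Sum>i<n. quad_form n X (q i)) = real m"
      using X unfolding fractional_projection_def by simp
  qed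
  also have "\<dots> = mat_inner n A X" by (rule mat_inner_spectral[OF spec, symmetric])
  finally show ?thesis .
qed

text \<open>
The orthogonal projection onto the span of the first \<open>m\<close> eigenvectors attains the sum.
\<close>

lemma greatest_eigenvalues_attained:
  fixes A :: "real mat"
  assumes A: "A \<in> carrier_mat n n" and sym: "transpose_mat A = A" and m: "m \<le> n"
  obtains P where "fractional_projection n m P" "mat_inner n A P = (\<Sum>i=1..m. eigval A i)"
proof -
  obtain q where spec: "\<And>u v. u < n \<Longrightarrow> v < n \<Longrightarrow>
        A $$ (u, v) = (\<Sum>i<n. eigval A (Suc i) * (q i u * q i v))"
    and complete: "\<And>u v. u < n \<Longrightarrow> v < n \<Longrightarrow> (\<Sum>i<n. q i u * q i v) = of_bool (u = v)"
    and orth: "\<And>i j. i < n \<Longrightarrow> j < n \<Longrightarrow> (\<Sum>u<n. q i u * q j u) = of_bool (i = j)"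
    and "\<And>i j. i \<le> j \<Longrightarrow> j < n \<Longrightarrow> eigval A (Suc j) \<le> eigval A (Suc i)"
    using symmetric_spectral_decomposition[OF A sym] by blast
  define P where "P u v = (\<Sum>i<m. q i u * q i v)" for u v
  have gram: "quad_form n P x = (\<Sum>i<m. (\<Sum>u<n. q i u * x u)\<^sup>2)" for x
    unfolding P_def by (rule quad_form_gram) simp
  have "psd n P" unfolding psd_def gram by (simp add: sum_nonneg)
  moreover have "psd n (\<lambda>u v. of_bool (u = v) - P u v)"
    unfolding psd_def
  proof
    fix x
    have "quad_form n (\<lambda>u v. of_bool (u = v)) x = quad_form n (\<lambda>u v. \<Sum>i<n. q i u * q i v) x"
      unfolding quad_form_def by (intro sum.cong refl) (auto simp: complete)
    also have "\<dots> = (\<Sum>i<n. (\<Sum>u<n. q i u * x u)\<^sup>2)" by (rule quad_form_gram) simp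
    also have "\<dots> \<ge> quad_form n P x"
      unfolding gram by (rule sum_mono2) (use m in auto)
    finally show "0 \<le> quad_form n (\<lambda>u v. of_bool (u = v) - P u v) x"
      by (simp add: quad_form_diff)
  qed
  moreover have "(\<Sum>u<n. P u u) = real m"
  proof -
    have "(\<Sum>u<n. P u u) = (\<Sum>i<m. \<Sum>u<n. q i u * q i u)"
      unfolding P_def by (rule sum.swap)
    also have "\<dots> = (\<Sum>i<m. 1)" by (intro sum.cong refl) (use orth m in auto)
    finally show ?thesis by simp
  qed
  ultimately have "fractional_projection n m P" unfolding fractional_projection_def by blast
  moreover have "mat_inner n A P = (\<Sum>i=1..m. eigval A i)"
  proof -
    have w: "quad_form n P (q i) = of_bool (i < m)" if "i < n" for i
    proof -
      have "quad_form n P (q i) = (\<Sum>j<m. of_bool (i = j))"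
        unfolding gram by (intro sum.cong refl) (use orth that m in auto)
      then show ?thesis by simp
    qed
    have "mat_inner n A P = (\<Sum>i<n. eigval A (Suc i) * quad_form n P (q i))"
      by (rule mat_inner_spectral[OF spec])
    also have "\<dots> = (\<Sum>i<n. eigval A (Suc i) * of_bool (i < m))"
      by (intro sum.cong refl) (simp add: w)
    also have "\<dots> = (\<Sum>i<m. eigval A (Suc i))"
      by (rule sum.mono_neutral_cong_right) (use m in auto)
    also have "\<dots> = (\<Sum>i=1..m. eigval A i)"
      by (rule sum.reindex_bij_witness[where i = "\<lambda>i. i - 1" and j = Suc]) auto
    finally show ?thesis .
  qed
  ultimately show thesis by (rule that)
qed

lemma fractional_projection_scaled_identity:
  assumes "m \<le> n" "n > 0"
  shows "fractional_projection n m (\<lambda>u v. real m / real n * of_bool (u = v))"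
proof -
  have scaled: "quad_form n (\<lambda>u v. a * of_bool (u = v)) x = a * (\<Sum>u<n. (x u)\<^sup>2)" for a x
    unfolding quad_form_identity[symmetric] by (simp add: quad_form_def sum_distrib_left mult_ac)
  have "quad_form n (\<lambda>u v. of_bool (u = v) - real m / real n * of_bool (u = v)) x
      = (1 - real m / real n) * (\<Sum>u<n. (x u)\<^sup>2)" for x
    unfolding quad_form_diff scaled quad_form_identity by (simp add: left_diff_distrib)
  moreover have "0 \<le> a * (\<Sum>u<n. (x u)\<^sup>2)" if "a \<ge> 0" for a and x :: "nat \<Rightarrow> real"
    using that by (simp add: sum_nonneg)
  ultimately show ?thesis
    unfolding fractional_projection_def psd_def scaled using assms by simp
qed

section \<open>Twisting by a regular simplex\<close>

text \<open>
The Schur product of \<open>P\<close> with the Gram matrix of the vertices \<open>w (c u)\<close>, where the \<open>w a\<close> are the \<open>k\<close> unit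
vertex vectors of a regular simplex centered at the origin, with inner products \<open>-1/(k-1)\<close>.
\<close>

definition simplex_twist :: "('c \<Rightarrow> 'k) \<Rightarrow> nat \<Rightarrow> ('c \<Rightarrow> 'c \<Rightarrow> real) \<Rightarrow> 'c \<Rightarrow> 'c \<Rightarrow> real" where
  "simplex_twist c k P u v = (if c u = c v then P u v else - P u v / (real k - 1))"

text \<open>
Up to a positive factor, the twisted form at \<open>x\<close> is \<open>k \<Sum>\<^sub>a P(y\<^sub>a) - P(\<Sum>\<^sub>a y\<^sub>a)\<close>, where \<open>y\<^sub>a\<close> is the
restriction of \<open>x\<close> to the color \<open>a\<close>. This is nonnegative by convexity of \<open>P\<close>; explicitly, twice it
is the sum of \<open>P(y\<^sub>a - y\<^sub>b)\<close> over all pairs of colors.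
\<close>

lemma psd_simplex_twist:
  fixes c :: "nat \<Rightarrow> 'b"
  assumes C: "finite C" "card C = k" "k \<ge> 2" and c: "\<And>u. u < n \<Longrightarrow> c u \<in> C"
    and P: "psd n P"
  shows "psd n (simplex_twist c k P)"
  unfolding psd_def
proof
  fix x
  define y :: "'b \<Rightarrow> nat \<Rightarrow> real" where "y a u = x u * of_bool (c u = a)" for a u
  have cross: "(\<Sum>a\<in>C. \<Sum>b\<in>C. (y a u - y b u) * (y a v - y b v)) =
      2 * (real k * of_bool (c u = c v) - 1) * (x u * x v)" if "u < n" "v < n" for u v
  proof -
    have one: "(\<Sum>a\<in>C. y a w) = x w" if "w < n" for w
      unfolding y_def sum_distrib_left[symmetric] using C c[OF that] by simp
    have both: "(\<Sum>a\<in>C. y a u * y a v) = of_bool (c u = c v) * (x u * x v)"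
    proof -
      have "(\<Sum>a\<in>C. y a u * y a v) = (\<Sum>a\<in>C. (of_bool (c u = c v) * (x u * x v)) * of_bool (c u = a))"
        by (intro sum.cong refl) (auto simp: y_def)
      also have "\<dots> = of_bool (c u = c v) * (x u * x v)"
        unfolding sum_distrib_left[symmetric] using C c[OF \<open>u < n\<close>] by simp
      finally show ?thesis .
    qed
    have "(\<Sum>a\<in>C. \<Sum>b\<in>C. (y a u - y b u) * (y a v - y b v)) =
        (\<Sum>a\<in>C. \<Sum>b\<in>C. y a u * y a v + y b u * y b v - y a u * y b v - y b u * y a v)"
      by (intro sum.cong refl) (simp add: algebra_simps)
    also have "\<dots> = 2 * (real k * (\<Sum>a\<in>C. y a u * y a v)) - 2 * ((\<Sum>a\<in>C. y a u) * (\<Sum>b\<in>C. y b v))"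
      using C(2) by (simp add: sum.distrib sum_subtractf flip: sum_distrib_left sum_distrib_right)
    finally have "(\<Sum>a\<in>C. \<Sum>b\<in>C. (y a u - y b u) * (y a v - y b v)) =
        2 * (real k * (\<Sum>a\<in>C. y a u * y a v)) - 2 * ((\<Sum>a\<in>C. y a u) * (\<Sum>b\<in>C. y b v))" .
    then show ?thesis unfolding both one[OF that(1)] one[OF that(2)] by (simp add: algebra_simps)
  qed
  have "0 \<le> (\<Sum>a\<in>C. \<Sum>b\<in>C. quad_form n P (\<lambda>u. y a u - y b u))"
    using P unfolding psd_def by (simp add: sum_nonneg)
  also have "\<dots> = (\<Sum>a\<in>C. \<Sum>u<n. \<Sum>v<n. \<Sum>b\<in>C. P u v * ((y a u - y b u) * (y a v - y b v)))"
    unfolding quad_form_def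
    by (simp add: sum.swap[of _ C "{..<n}"])
  also have "\<dots> = (\<Sum>u<n. \<Sum>v<n. P u v * (\<Sum>a\<in>C. \<Sum>b\<in>C. (y a u - y b u) * (y a v - y b v)))"
    unfolding sum_distrib_left by (simp add: sum.swap[of _ C "{..<n}"])
  also have "\<dots> = (\<Sum>u<n. \<Sum>v<n. P u v * (2 * (real k * of_bool (c u = c v) - 1) * (x u * x v)))"
    by (intro sum.cong refl) (simp add: cross)
  also have "\<dots> = 2 * (real k - 1) * quad_form n (simplex_twist c k P) x"
    unfolding quad_form_def sum_distrib_left using C(3)
    by (intro sum.cong refl) (auto simp: simplex_twist_def field_simps)
  finally show "0 \<le> quad_form n (simplex_twist c k P) x"
    using C(3) by (simp add: zero_le_mult_iff)
qed

text \<open>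
The twist fixes the diagonal. Hence it preserves the trace and the identity matrix, and so
\<open>1 - X\<close> is the twist of \<open>1 - P\<close>.
\<close>

lemma fractional_projection_simplex_twist:
  assumes C: "finite C" "card C = k" "k \<ge> 2" and c: "\<And>u. u < n \<Longrightarrow> c u \<in> C"
    and P: "fractional_projection n m P"
  shows "fractional_projection n m (simplex_twist c k P)"
proof -
  have "(\<lambda>u v. of_bool (u = v) - simplex_twist c k P u v) =
      simplex_twist c k (\<lambda>u v. of_bool (u = v) - P u v)"
    by (intro ext) (auto simp: simplex_twist_def)
  then show ?thesis
    using P psd_simplex_twist[OF C c] unfolding fractional_projection_def
    by (auto simp: simplex_twist_def)
qed

text \<open>
The Hoffman-type bound behind the theorem, for two arbitrary symmetric matrices of trace zero whose sum
vanishes inside the color classes.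
\<close>

lemma eigenvalue_ratio_bound:
  fixes A B :: "real mat"
  assumes A: "A \<in> carrier_mat n n" "transpose_mat A = A"
    and B: "B \<in> carrier_mat n n" "transpose_mat B = B"
    and trace: "(\<Sum>u<n. A $$ (u, u)) = 0" "(\<Sum>u<n. B $$ (u, u)) = 0"
    and C: "finite C" "card C = k" "k \<ge> 2" and c: "\<And>u. u < n \<Longrightarrow> c u \<in> C"
    and vanish: "\<And>u v. u < n \<Longrightarrow> v < n \<Longrightarrow> c u = c v \<Longrightarrow> A $$ (u, v) + B $$ (u, v) = 0"
    and m: "1 \<le> m" "m \<le> n"
  shows "((\<Sum>i=1..m. eigval A i) + (\<Sum>i=1..m. eigval B (n - i + 1))) /
         (- (\<Sum>i=1..m. eigval A (n - i + 1)) - (\<Sum>i=1..m. eigval B (n - i + 1))) \<le> real k - 1"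
    (is "(?topA + ?botB) / (- ?botA - ?botB) \<le> _")
proof -
  obtain P where P: "fractional_projection n m P" and PA: "mat_inner n A P = ?topA"
    using greatest_eigenvalues_attained[OF A m(2)] .
  let ?X = "simplex_twist c k P"
  have X: "fractional_projection n m ?X"
    by (rule fractional_projection_simplex_twist[OF C c P])
  have add: "mat_inner n A Y + mat_inner n B Y =
      (\<Sum>u<n. \<Sum>v<n. (A $$ (u, v) + B $$ (u, v)) * Y u v)" for Y
    by (simp add: mat_inner_def sum.distrib distrib_right)
  have "?topA + ?botB \<le> mat_inner n A P + mat_inner n B P"
    using least_eigenvalues_le_mat_inner[OF B P m] PA by simp
  also have "\<dots> = (\<Sum>u<n. \<Sum>v<n. - (real k - 1) * ((A $$ (u, v) + B $$ (u, v)) * ?X u v))"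
    unfolding add
  proof (intro sum.cong refl)
    fix u v assume "u \<in> {..<n}" "v \<in> {..<n}"
    then have "c u = c v \<Longrightarrow> A $$ (u, v) + B $$ (u, v) = 0" using vanish by simp
    moreover have "P u v = - (real k - 1) * ?X u v" if "c u \<noteq> c v"
      using that C(3) by (simp add: simplex_twist_def minus_divide_right)
    ultimately show "(A $$ (u, v) + B $$ (u, v)) * P u v =
        - (real k - 1) * ((A $$ (u, v) + B $$ (u, v)) * ?X u v)"
      by (cases "c u = c v") simp_all
  qed
  also have "\<dots> = - (real k - 1) * (mat_inner n A ?X + mat_inner n B ?X)"
    unfolding add sum_distrib_left ..
  also have "\<dots> \<le> (real k - 1) * (- ?botA - ?botB)"
  proof -
    have "?botA + ?botB \<le> mat_inner n A ?X + mat_inner n B ?X"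
      using least_eigenvalues_le_mat_inner[OF A X m] least_eigenvalues_le_mat_inner[OF B X m] by simp
    then have "(real k - 1) * (?botA + ?botB) \<le> (real k - 1) * (mat_inner n A ?X + mat_inner n B ?X)"
      using C(3) by (intro mult_left_mono) auto
    then show ?thesis by (simp add: algebra_simps)
  qed
  finally have bound: "?topA + ?botB \<le> (real k - 1) * (- ?botA - ?botB)" .
  \<comment> \<open>The denominator is nonnegative: test both matrices on the multiple of the identity of trace \<open>m\<close>.\<close>
  have "?botA + ?botB \<le> 0"
  proof -
    let ?I = "\<lambda>u v. real m / real n * of_bool (u = v)"
    have I: "fractional_projection n m ?I"
      using m by (intro fractional_projection_scaled_identity) auto
    have "mat_inner n M ?I = real m / real n * (\<Sum>u<n. M $$ (u, u))" for M
    proof -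
      have "mat_inner n M ?I = (\<Sum>u<n. \<Sum>v<n. of_bool (u = v) * (real m / real n * M $$ (u, v)))"
        by (simp add: mat_inner_def mult_ac)
      also have "\<dots> = (\<Sum>u<n. real m / real n * M $$ (u, u))"
        by (intro sum.cong refl) (simp only: sum_of_bool_mult lessThan_iff)
      finally show ?thesis by (simp add: sum_distrib_left)
    qed
    then show ?thesis
      using least_eigenvalues_le_mat_inner[OF A I m] least_eigenvalues_le_mat_inner[OF B I m] trace
      by simp
  qed
  \<comment> \<open>For a vanishing denominator the quotient is 0, which is below \<open>k - 1\<close> as well.\<close>
  then show ?thesis
    using bound C(3) by (cases "?botA + ?botB = 0") (auto simp: divide_le_eq)
qed

section \<open>Colorings of signed graphs\<close>

lemma color_set_finite: "finite (color_set k)"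
  by (simp add: color_set_def)

lemma color_set_card: "card (color_set k) = k"
proof (cases "even k")
  case True
  then obtain j where k: "k = 2 * j" by (rule evenE)
  then have "color_set k = {- int j..int j} - {0}" by (simp add: color_set_def)
  then show ?thesis by (simp add: card_Diff_singleton k)
next
  case False
  then obtain j where k: "k = 2 * j + 1" by (rule oddE)
  then show ?thesis by (simp add: color_set_def)
qed

text \<open>
With pairwise distinct positive colors, neither a positive nor a negative edge is violated.
\<close>

lemma signed_coloring_exists:
  assumes S: "is_signed_graph S"
  shows "\<exists>c. signed_coloring S (2 * card (verts S)) c"
proof -
  let ?n = "card (verts S)"
  obtain h where h: "bij_betw h (verts S) {0..<?n}"
    using ex_bij_betw_finite_nat[of "verts S"] S unfolding is_signed_graph_def by auto
  define c where "c x = int (h x) + 1" for x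
  have bound: "h x < ?n" if "x \<in> verts S" for x
    using bij_betwE[OF h] that by force
  have "c u \<noteq> edge_sign S {u, v} * c v" if e: "{u, v} \<in> edges S" for u v
  proof -
    have "{u, v} \<subseteq> verts S" "card {u, v} = 2" and sgn: "edge_sign S {u, v} \<in> {-1, 1}"
      using S e unfolding is_signed_graph_def by auto
    then have uv: "u \<in> verts S" "v \<in> verts S" "u \<noteq> v" by auto
    then have "h u \<noteq> h v" using h unfolding bij_betw_def inj_on_def by blast
    then show ?thesis using sgn by (auto simp: c_def)
  qed
  moreover have "c \<in> verts S \<rightarrow> color_set (2 * ?n)"
    using bound by (force simp: c_def color_set_def)
  ultimately show ?thesis unfolding signed_coloring_def by blast
qed

lemma signed_chromatic_number_coloring:
  assumes S: "is_signed_graph S" and "verts S \<noteq> {}"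
  obtains c where "signed_coloring S (signed_chromatic_number S) c"
proof -
  have "card (verts S) > 0" using assms by (auto simp: is_signed_graph_def card_gt_0_iff)
  then have "\<exists>k. 1 \<le> k \<and> (\<exists>c. signed_coloring S k c)"
    using signed_coloring_exists[OF S] by (intro exI[of _ "2 * card (verts S)"]) auto
  from LeastI_ex[OF this] show thesis
    using that unfolding signed_chromatic_number_def by blast
qed

lemma positive_edge_colors_differ:
  assumes "is_signed_graph S" "signed_coloring S k c" "{x, y} \<in> edges S" "edge_sign S {x, y} = 1"
  shows "c x \<noteq> c y"
  using assms unfolding signed_coloring_def by force

lemma adjacency_matrix_carrier: "adjacency_matrix S vs \<in> carrier_mat (length vs) (length vs)"
  by (simp add: adjacency_matrix_def)

lemma adjacency_matrix_symmetric: "transpose_mat (adjacency_matrix S vs) = adjacency_matrix S vs"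
  by (rule eq_matI) (auto simp: adjacency_matrix_def insert_commute)

theorem corollary4p9:
  fixes S :: "'a signed_graph" and vs :: "'a list" and n :: nat and A B :: "real mat"
  assumes "is_signed_graph S"
    and "distinct vs" and "set vs = verts S"
    and "n = card (verts S)"
    and "\<exists>e\<in>edges S. edge_sign S e = 1"
    and "A = adjacency_matrix S vs"
    and "B = - adjacency_matrix (negative_part S) vs"
  shows "real (signed_chromatic_number S) \<ge>
    1 + Max ((\<lambda>m. ((\<Sum>i=1..m. eigval A i) + (\<Sum>i=1..m. eigval B (n - i + 1))) /
                   (- (\<Sum>i=1..m. eigval A (n - i + 1)) - (\<Sum>i=1..m. eigval B (n - i + 1))))
             ` {1..n-1})"
proof -
  let ?k = "signed_chromatic_number S"
  have n: "n = length vs" using assms(2-4) distinct_card by metis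
  obtain e where e: "e \<in> edges S" "edge_sign S e = 1" using assms(5) by blast
  then have eV: "e \<subseteq> verts S" and "card e = 2" using assms(1) unfolding is_signed_graph_def by auto
  then obtain x y where xy: "e = {x, y}" "x \<noteq> y" by (meson card_2_iff)
  have "n \<ge> 2"
    using card_mono[OF _ eV] \<open>card e = 2\<close> assms(1,4) unfolding is_signed_graph_def by simp
  have "verts S \<noteq> {}" using eV xy by auto
  then obtain c where c: "signed_coloring S ?k c"
    using signed_chromatic_number_coloring[OF assms(1)] by blast
  have range: "c u \<in> color_set ?k" if "u \<in> verts S" for u
    using c that unfolding signed_coloring_def by blast
  \<comment> \<open>The two ends of a positive edge need different colors.\<close>
  have "?k \<ge> 2"
  proof -
    have "c x \<noteq> c y" using positive_edge_colors_differ[OF assms(1) c] e xy by simp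
    moreover have "{c x, c y} \<subseteq> color_set ?k" using range eV xy by auto
    ultimately show ?thesis
      using card_mono[OF color_set_finite, of "{c x, c y}" ?k] by (simp add: color_set_card)
  qed
  let ?N = "adjacency_matrix (negative_part S) vs"
  have A: "A \<in> carrier_mat n n" "transpose_mat A = A"
    unfolding assms(6) n by (rule adjacency_matrix_carrier adjacency_matrix_symmetric)+
  have N: "?N \<in> carrier_mat n n" unfolding n by (rule adjacency_matrix_carrier)
  then have B: "B \<in> carrier_mat n n" unfolding assms(7) by simp
  have symB: "transpose_mat B = B"
    unfolding assms(7) using adjacency_matrix_symmetric[of "negative_part S" vs] N
    by (simp add: transpose_uminus)
  have no_loop: "{x} \<notin> edges S" for x
    using assms(1) unfolding is_signed_graph_def by force
  have trace: "(\<Sum>u<n. A $$ (u, u)) = 0" "(\<Sum>u<n. B $$ (u, u)) = 0"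
    unfolding assms(6,7) n
    by (auto simp: adjacency_matrix_def negative_part_def no_loop)
  have vanish: "A $$ (u, v) + B $$ (u, v) = 0"
    if uv: "u < n" "v < n" and same: "c (vs ! u) = c (vs ! v)" for u v
  proof (cases "{vs ! u, vs ! v} \<in> edges S")
    case True
    then have "edge_sign S {vs ! u, vs ! v} = -1"
      using positive_edge_colors_differ[OF assms(1) c True] same assms(1)
      unfolding is_signed_graph_def by blast
    then show ?thesis using uv True unfolding assms(6,7) n
      by (simp add: adjacency_matrix_def negative_part_def)
  next
    case False
    then show ?thesis using uv unfolding assms(6,7) n
      by (simp add: adjacency_matrix_def negative_part_def)
  qed
  have cV: "c (vs ! u) \<in> color_set ?k" if "u < n" for u
    using range nth_mem[of u vs] that n assms(3) by simp
  let ?ratio = "\<lambda>m. ((\<Sum>i=1..m. eigval A i) + (\<Sum>i=1..m. eigval B (n - i + 1))) /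
                   (- (\<Sum>i=1..m. eigval A (n - i + 1)) - (\<Sum>i=1..m. eigval B (n - i + 1)))"
  have "Max (?ratio ` {1..n-1}) \<le> real ?k - 1"
  proof (rule Max.boundedI)
    fix r assume "r \<in> ?ratio ` {1..n-1}"
    then obtain m where m: "r = ?ratio m" "1 \<le> m" "m \<le> n" by auto
    show "r \<le> real ?k - 1"
      unfolding m(1)
    proof (rule eigenvalue_ratio_bound[where c = "\<lambda>u. c (vs ! u)"])
      show "c (vs ! u) \<in> color_set ?k" if "u < n" for u by (rule cV[OF that])
      show "A $$ (u, v) + B $$ (u, v) = 0"
        if "u < n" "v < n" "c (vs ! u) = c (vs ! v)" for u v by (rule vanish[OF that])
    qed (fact A B symB trace color_set_finite color_set_card \<open>?k \<ge> 2\<close> m)+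
  qed (use \<open>n \<ge> 2\<close> in auto)
  then show ?thesis by linarith
qed

end
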